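(* Let $i,j,z\in\mathbb{N}$ and let $Y$ be any Young diagram with $z$ steps. (i) If $z<\binom{i+j}{i}$, then there exists an $(i,j)$-local partition of $Y$ into actual rectangles. (ii) If $z\ge\binom{i+j}{i}$, then there exists no $(i,j)$-local cover of $Y$ by generalized rectangles.
   Context: $\mathbb{N}=\{1,2,\dots\}$ and $[x]=\{1,\dots,x\}$. A Young diagram with $r$ rows and $c$ columns is a set $Y\subseteq [r]\times[c]$ such that whenever $(i,j)\in Y$, then $(i-1,j)\in Y$ if $i\ge 2$ and $(i,j-1)\in Y$ if $j\ge 2$. A generalized rectangle in $Y$ is a set $R=S\times T$ with $S\subseteq[r]$, $T\subseteq[c]$ and $R\subseteq Y$; it uses the rows in $S$ and the columns in $T$. It is an actual rectangle if $S$ and $T$ are each sets of consecutive integers. A cover of $Y$ is a set $C$ of generalized rectangles with $\bigcup_{R\in C}R=Y$; it is a partition if the rectangles in $C$ are pairwise disjoint. A cover is $(i,j)$-local if each row of $Y$ is used by at most $i$ rectangles of $C$ and each column of $Y$ is used by at most $j$ rectangles of $C$. The steps of $Y$ are the cells $(s,t)\in Y$ with $(s+1,t)\notin Y$ and $(s,t+1)\notin Y$. *)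

theory Defs
  imports Main
begin

type_synonym cell = "nat \<times> nat"

(* Rows and columns are numbered from 1; the cell (s, t) lies in row s and column t. *)

definition young_diagram :: "nat \<Rightarrow> nat \<Rightarrow> cell set \<Rightarrow> bool" where
  "young_diagram r c Y \<longleftrightarrow>
     Y \<subseteq> {1..r} \<times> {1..c} \<and>
     (\<forall>s t. (s, t) \<in> Y \<longrightarrow>
        (2 \<le> s \<longrightarrow> (s - 1, t) \<in> Y) \<and> (2 \<le> t \<longrightarrow> (s, t - 1) \<in> Y))"

definition steps :: "cell set \<Rightarrow> cell set" where
  "steps Y = {(s, t). (s, t) \<in> Y \<and> (s + 1, t) \<notin> Y \<and> (s, t + 1) \<notin> Y}"

definition generalized_rectangle :: "nat \<Rightarrow> nat \<Rightarrow> cell set \<Rightarrow> cell set \<Rightarrow> bool" where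
  "generalized_rectangle r c Y R \<longleftrightarrow>
     (\<exists>S T. S \<subseteq> {1..r} \<and> T \<subseteq> {1..c} \<and> R = S \<times> T \<and> R \<subseteq> Y)"

(* Sets of consecutive integers are taken to be nonempty. *)
definition consecutive :: "nat set \<Rightarrow> bool" where
  "consecutive S \<longleftrightarrow> (\<exists>a b. a \<le> b \<and> S = {a..b})"

definition actual_rectangle :: "nat \<Rightarrow> nat \<Rightarrow> cell set \<Rightarrow> cell set \<Rightarrow> bool" where
  "actual_rectangle r c Y R \<longleftrightarrow>
     (\<exists>S T. S \<subseteq> {1..r} \<and> T \<subseteq> {1..c} \<and> R = S \<times> T \<and> R \<subseteq> Y \<and>
            consecutive S \<and> consecutive T)"

(* A nonempty rectangle R = S \<times> T determines S = fst ` R and T = snd ` R.  The empty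
   rectangle, for which S and T are not determined, uses no row and no column. *)

definition rows_used :: "cell set \<Rightarrow> nat set" where
  "rows_used R = fst ` R"

definition columns_used :: "cell set \<Rightarrow> nat set" where
  "columns_used R = snd ` R"

definition is_cover :: "nat \<Rightarrow> nat \<Rightarrow> cell set \<Rightarrow> cell set set \<Rightarrow> bool" where
  "is_cover r c Y C \<longleftrightarrow> (\<forall>R\<in>C. generalized_rectangle r c Y R) \<and> \<Union> C = Y"

definition is_partition :: "nat \<Rightarrow> nat \<Rightarrow> cell set \<Rightarrow> cell set set \<Rightarrow> bool" where
  "is_partition r c Y C \<longleftrightarrow> is_cover r c Y C \<and> pairwise disjnt C"

(* No finiteness condition is needed for card: the members of a cover are subsets of the
   finite set Y, so every cover is finite. *)
definition is_local :: "nat \<Rightarrow> nat \<Rightarrow> nat \<Rightarrow> nat \<Rightarrow> cell set set \<Rightarrow> bool" where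
  "is_local i j r c C \<longleftrightarrow>
     (\<forall>s\<in>{1..r}. card {R \<in> C. s \<in> rows_used R} \<le> i) \<and>
     (\<forall>t\<in>{1..c}. card {R \<in> C. t \<in> columns_used R} \<le> j)"

end

theory Submission
  imports Defs
begin

text \<open>
  For (i), cut at a step \<open>(a, b)\<close> and use the rectangle \<open>[a] \<times> [b]\<close>. What remains is a diagram to
  the right, whose rows have lost one of their \<open>i\<close> rectangles, and a diagram below, whose columns
  have lost one of their \<open>j\<close> rectangles; Pascal's rule lets the step be chosen so that both are small
  enough for induction.

  For (ii), let \<open>A k\<close> and \<open>B k\<close> be the sets of rectangles using the row and the column of the
  \<open>k\<close>-th step; then \<open>A k\<close> meets \<open>B l\<close> iff \<open>k \<le> l\<close>. Split the steps at \<open>m\<close> by Pascal's rule. By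
  induction, the rectangles that use a column before \<open>m\<close> cannot be \<open>(i-1, j)\<close>-local on the steps
  before \<open>m\<close>, so there is a row \<open>k < m\<close> all of whose rectangles use some column before \<open>m\<close>.
  Dually there is a column \<open>l \<ge> m\<close> all of whose rectangles use some row from \<open>m\<close> on. A rectangle
  covering the crossing of this row and this column would contain a cell outside the diagram.
\<close>

section \<open>Set families with a triangular intersection pattern\<close>

lemma choose_Suc_add_Suc:
  "(Suc i + Suc j) choose Suc i = ((i + Suc j) choose i) + ((Suc i + j) choose Suc i)"
  by simp

text \<open>Part (ii) with the geometry removed: only the pattern of intersections remains. The
  indices run from \<open>p\<close> up to \<open>q\<close> instead of from 0, so that the induction
  can use either half with its original numbering.\<close>

lemma triangular_intersections_less_choose:
  fixes A B :: "nat \<Rightarrow> 'a set"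
  assumes "\<And>k. \<lbrakk>p \<le> k; k < q\<rbrakk> \<Longrightarrow> finite (A k) \<and> card (A k) \<le> i"
    and "\<And>k. \<lbrakk>p \<le> k; k < q\<rbrakk> \<Longrightarrow> finite (B k) \<and> card (B k) \<le> j"
    and "\<And>k l. \<lbrakk>p \<le> k; k \<le> l; l < q\<rbrakk> \<Longrightarrow> A k \<inter> B l \<noteq> {}"
    and "\<And>k l. \<lbrakk>p \<le> l; l < k; k < q\<rbrakk> \<Longrightarrow> A k \<inter> B l = {}"
  shows "q - p < (i + j) choose i"
  using assms
proof (induction "i + j" arbitrary: i j p q A B rule: less_induct)
  case less
  note cardA = less.prems(1) and cardB = less.prems(2)
    and meet = less.prems(3) and apart = less.prems(4)
  show ?case
  proof (cases "i = 0 \<or> j = 0")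
    case True
    have "q \<le> p"
    proof (rule ccontr)
      assume "\<not> q \<le> p"
      then have "A p = {} \<or> B p = {}" using cardA[of p] cardB[of p] True by auto
      then show False using meet[of p p] \<open>\<not> q \<le> p\<close> by auto
    qed
    then show ?thesis by simp
  next
    case False
    then obtain i' j' where ij: "i = Suc i'" "j = Suc j'" by (metis not0_implies_Suc)
    show ?thesis
    proof (rule ccontr)
      assume neg: "\<not> ?thesis"
      \<comment> \<open>The first half gets exactly as many indices as the strict bound for
        \<open>i'\<close> and \<open>j\<close> forbids, and Pascal's rule leaves the second half at
        least as many as the bound for \<open>i\<close> and \<open>j'\<close> forbids. Positivity of
        the coefficient is needed because \<open>q - p\<close> is truncated subtraction.\<close>
      define m where "m = p + ((i' + j) choose i')"
      have "(i + j) choose i = ((i' + j) choose i') + ((i + j') choose i)"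
        unfolding ij by (rule choose_Suc_add_Suc)
      then have large: "m \<le> q" "(i + j') choose i \<le> q - m"
        using neg zero_less_binomial[of i' "i' + j"] unfolding m_def by linarith+
      \<comment> \<open>Otherwise discarding from every \<open>A k\<close> the elements in no
        \<open>B l\<close> of this half removes at least one element each time, while the
        intersections with these \<open>B l\<close> stay the same. The induction hypothesis for
        \<open>i'\<close> and \<open>j\<close> then makes the half too short.\<close>
      have "\<exists>k. p \<le> k \<and> k < m \<and> A k \<subseteq> \<Union> (B ` {p..<m})"
      proof (rule ccontr)
        assume none: "\<not> ?thesis"
        have "m - p < (i' + j) choose i'"
        proof (rule less.hyps[of i' j p m "\<lambda>k. A k \<inter> \<Union> (B ` {p..<m})" B])
          fix k assume k: "p \<le> k" "k < m"
          then have "A k \<inter> \<Union> (B ` {p..<m}) \<subset> A k" using none by blast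
          then have "card (A k \<inter> \<Union> (B ` {p..<m})) < card (A k)"
            using cardA[of k] k large(1) by (intro psubset_card_mono) auto
          then show "finite (A k \<inter> \<Union> (B ` {p..<m})) \<and> card (A k \<inter> \<Union> (B ` {p..<m})) \<le> i'"
            using cardA[of k] k large(1) ij by auto
        next
          fix k l assume "p \<le> k" "k \<le> l" "l < m"
          then show "(A k \<inter> \<Union> (B ` {p..<m})) \<inter> B l \<noteq> {}"
            using meet[of k l] large(1) by fastforce
        next
          fix k l assume "p \<le> l" "l < k" "k < m"
          then show "(A k \<inter> \<Union> (B ` {p..<m})) \<inter> B l = {}"
            using apart[of l k] large(1) by auto
        qed (use ij cardB large(1) in auto)
        then show False by (simp add: m_def)
      qed
      then obtain k where k: "p \<le> k" "k < m" "A k \<subseteq> \<Union> (B ` {p..<m})" by blast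
      have "\<exists>l. m \<le> l \<and> l < q \<and> B l \<subseteq> \<Union> (A ` {m..<q})"
      proof (rule ccontr)
        assume none: "\<not> ?thesis"
        have pm: "p \<le> m" by (simp add: m_def)
        have "q - m < (i + j') choose i"
        proof (rule less.hyps[of i j' m q A "\<lambda>l. B l \<inter> \<Union> (A ` {m..<q})"])
          fix l assume l: "m \<le> l" "l < q"
          then have "B l \<inter> \<Union> (A ` {m..<q}) \<subset> B l" using none by blast
          then have "card (B l \<inter> \<Union> (A ` {m..<q})) < card (B l)"
            using cardB[of l] l pm by (intro psubset_card_mono) auto
          then show "finite (B l \<inter> \<Union> (A ` {m..<q})) \<and> card (B l \<inter> \<Union> (A ` {m..<q})) \<le> j'"
            using cardB[of l] l pm ij by auto
        next
          fix k l assume "m \<le> k" "k \<le> l" "l < q"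
          then show "A k \<inter> (B l \<inter> \<Union> (A ` {m..<q})) \<noteq> {}"
            using meet[of k l] pm by fastforce
        next
          fix k l assume "m \<le> l" "l < k" "k < q"
          then show "A k \<inter> (B l \<inter> \<Union> (A ` {m..<q})) = {}"
            using apart[of l k] pm by auto
        qed (use ij cardA pm in auto)
        then show False using large(2) by simp
      qed
      then obtain l where l: "m \<le> l" "l < q" "B l \<subseteq> \<Union> (A ` {m..<q})" by blast
      \<comment> \<open>As \<open>k < m\<close> and \<open>m \<le> l\<close>, the pattern provides a
        common element; the two inclusions then put it into some \<open>A k'\<close> and
        \<open>B l'\<close> with \<open>l' < k'\<close>, which are disjoint.\<close>
      obtain x where "x \<in> A k" "x \<in> B l" using meet[of k l] k l by fastforce
      then obtain k' l' where "p \<le> l'" "l' < m" "x \<in> B l'" "m \<le> k'" "k' < q" "x \<in> A k'"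
        using k(3) l(3) by fastforce
      then show False using apart[of l' k'] by auto
    qed
  qed
qed

section \<open>Local partitions of staircase shapes\<close>

definition descends :: "cell \<Rightarrow> cell \<Rightarrow> bool" where
  "descends u v \<longleftrightarrow> fst u < fst v \<and> snd v < snd u"

text \<open>A diagram given by its steps. The offset \<open>(p, q)\<close> is there because the
  diagrams to the right of and below a removed rectangle no longer begin at the cell (1, 1).\<close>

definition staircase :: "nat \<Rightarrow> nat \<Rightarrow> cell list \<Rightarrow> cell set" where
  "staircase p q xs = {(s, t). p < s \<and> q < t \<and> (\<exists>u\<in>set xs. s \<le> fst u \<and> t \<le> snd u)}"

text \<open>In the rows up to \<open>fst u\<close>, a cell beyond column \<open>snd u\<close> can
  only be dominated by an entry before \<open>u\<close>, since later entries have smaller columns. A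
  cell below row \<open>fst u\<close> needs an entry after \<open>u\<close>, which confines it to
  columns left of \<open>snd u\<close>.\<close>

lemma staircase_split:
  assumes "sorted_wrt descends (xs @ u # ys)" and "p < fst u" and "q < snd u"
  shows "staircase p q (xs @ u # ys) =
    {Suc p..fst u} \<times> {Suc q..snd u} \<union> (staircase p (snd u) xs \<union> staircase (fst u) q ys)"
proof (rule set_eqI)
  fix x :: cell
  obtain s t where x: "x = (s, t)" by (cases x)
  have before: "fst v < fst u \<and> snd u < snd v" if "v \<in> set xs" for v
    using that assms(1) by (auto simp: sorted_wrt_append descends_def)
  have after: "fst u < fst v \<and> snd v < snd u" if "v \<in> set ys" for v
    using that assms(1) by (auto simp: sorted_wrt_append descends_def)
  consider "s \<le> fst u" "t \<le> snd u" | "s \<le> fst u" "snd u < t" | "fst u < s" by linarith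
  then show "x \<in> staircase p q (xs @ u # ys) \<longleftrightarrow> x \<in> {Suc p..fst u} \<times> {Suc q..snd u} \<union>
    (staircase p (snd u) xs \<union> staircase (fst u) q ys)"
  proof cases
    case 1
    then show ?thesis by (auto simp: x staircase_def)
  next
    case 2
    then show ?thesis using assms(2,3) after by (fastforce simp: x staircase_def)
  next
    case 3
    then show ?thesis using assms(2,3) before by (fastforce simp: x staircase_def)
  qed
qed

lemma staircase_local_partition:
  assumes "length xs < (i + j) choose i" and "sorted_wrt descends xs"
    and "\<forall>u\<in>set xs. p < fst u \<and> q < snd u"
  shows "\<exists>C. finite C \<and> \<Union> C = staircase p q xs \<and> pairwise disjnt C \<and>
    (\<forall>R\<in>C. \<exists>a b c d. a \<le> b \<and> c \<le> d \<and> R = {a..b} \<times> {c..d}) \<and>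
    (\<forall>s. card {R \<in> C. s \<in> rows_used R} \<le> i) \<and> (\<forall>t. card {R \<in> C. t \<in> columns_used R} \<le> j)"
  using assms
proof (induction "i + j" arbitrary: i j p q xs rule: less_induct)
  case less
  show ?case
  proof (cases "xs = []")
    case True
    then show ?thesis by (intro exI[of _ "{}"]) (auto simp: staircase_def)
  next
    case False
    \<comment> \<open>If \<open>i\<close> or \<open>j\<close> is 0, the binomial coefficient is 1
      and only the empty list is short enough.\<close>
    have "i \<noteq> 0" "j \<noteq> 0" using less.prems(1) False by (auto intro: ccontr)
    then obtain i' j' where ij: "i = Suc i'" "j = Suc j'" by (metis not0_implies_Suc)
    have pascal: "(i + j) choose i = ((i' + j) choose i') + ((i + j') choose i)"
      unfolding ij by (rule choose_Suc_add_Suc)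
    have pos: "0 < (i' + j) choose i'" "0 < (i + j') choose i" by (auto simp: zero_less_binomial)
    \<comment> \<open>The cut leaves as many entries before \<open>u\<close> as the induction
      hypothesis for \<open>i'\<close> and \<open>j\<close> allows, so by Pascal's rule fewer than
      \<open>(i + j') choose i\<close> remain after it. The minimum keeps \<open>n\<close> a valid
      index when the list is shorter; then nothing remains after \<open>u\<close>.\<close>
    define n where "n = min (length xs - 1) (((i' + j) choose i') - 1)"
    define u where "u = xs ! n"
    define xs1 where "xs1 = take n xs"
    define xs2 where "xs2 = drop (Suc n) xs"
    have "n < length xs" using False unfolding n_def by (simp add: min_less_iff_disj)
    then have xs: "xs = xs1 @ u # xs2"
      unfolding xs1_def xs2_def u_def by (rule id_take_nth_drop)
    have len: "length xs1 < (i' + j) choose i'" "length xs2 < (i + j') choose i"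
    proof -
      have "length xs1 = n" "length xs2 = length xs - Suc n"
        using \<open>n < length xs\<close> by (simp_all add: xs1_def xs2_def)
      then show "length xs1 < (i' + j) choose i'" "length xs2 < (i + j') choose i"
        using pos pascal less.prems(1) unfolding n_def by linarith+
    qed
    have sorted: "sorted_wrt descends (xs1 @ u # xs2)" using less.prems(2) xs by simp
    have u: "p < fst u" "q < snd u" using less.prems(3) xs by auto
    have "\<exists>C. finite C \<and> \<Union> C = staircase p (snd u) xs1 \<and> pairwise disjnt C \<and>
      (\<forall>R\<in>C. \<exists>a b c d. a \<le> b \<and> c \<le> d \<and> R = {a..b} \<times> {c..d}) \<and>
      (\<forall>s. card {R \<in> C. s \<in> rows_used R} \<le> i') \<and> (\<forall>t. card {R \<in> C. t \<in> columns_used R} \<le> j)"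
      using sorted less.prems(3) xs len ij
      by (intro less.hyps) (auto simp: sorted_wrt_append descends_def)
    then obtain C1 where C1: "finite C1" "\<Union> C1 = staircase p (snd u) xs1" "pairwise disjnt C1"
      "\<forall>R\<in>C1. \<exists>a b c d. a \<le> b \<and> c \<le> d \<and> R = {a..b} \<times> {c..d}"
      "\<And>s. card {R \<in> C1. s \<in> rows_used R} \<le> i'" "\<And>t. card {R \<in> C1. t \<in> columns_used R} \<le> j"
      by blast
    have "\<exists>C. finite C \<and> \<Union> C = staircase (fst u) q xs2 \<and> pairwise disjnt C \<and>
      (\<forall>R\<in>C. \<exists>a b c d. a \<le> b \<and> c \<le> d \<and> R = {a..b} \<times> {c..d}) \<and>
      (\<forall>s. card {R \<in> C. s \<in> rows_used R} \<le> i) \<and> (\<forall>t. card {R \<in> C. t \<in> columns_used R} \<le> j')"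
      using sorted less.prems(3) xs len ij
      by (intro less.hyps) (auto simp: sorted_wrt_append descends_def)
    then obtain C2 where C2: "finite C2" "\<Union> C2 = staircase (fst u) q xs2" "pairwise disjnt C2"
      "\<forall>R\<in>C2. \<exists>a b c d. a \<le> b \<and> c \<le> d \<and> R = {a..b} \<times> {c..d}"
      "\<And>s. card {R \<in> C2. s \<in> rows_used R} \<le> i" "\<And>t. card {R \<in> C2. t \<in> columns_used R} \<le> j'"
      by blast
    define R0 where "R0 = {Suc p..fst u} \<times> {Suc q..snd u}"
    define C where "C = insert R0 (C1 \<union> C2)"
    \<comment> \<open>Row \<open>fst u\<close> and column \<open>snd u\<close> separate
      \<open>R0\<close>, \<open>C1\<close> and \<open>C2\<close>. This yields both the disjointness
      and the local counts: a row up to \<open>fst u\<close> meets only \<open>R0\<close> and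
      \<open>C1\<close>, a lower row only \<open>C2\<close>, and dually for columns.\<close>
    have cells1: "s \<le> fst u \<and> snd u < t" if "R \<in> C1" "(s, t) \<in> R" for R s t
    proof -
      have "(s, t) \<in> staircase p (snd u) xs1" using that C1(2) by blast
      then show ?thesis using sorted by (fastforce simp: staircase_def sorted_wrt_append descends_def)
    qed
    have cells2: "fst u < s \<and> t \<le> snd u" if "R \<in> C2" "(s, t) \<in> R" for R s t
    proof -
      have "(s, t) \<in> staircase (fst u) q xs2" using that C2(2) by blast
      then show ?thesis using sorted by (fastforce simp: staircase_def sorted_wrt_append descends_def)
    qed
    have cells0: "s \<le> fst u \<and> t \<le> snd u" if "(s, t) \<in> R0" for s t
      using that by (simp add: R0_def)
    have "finite C" using C1(1) C2(1) by (simp add: C_def)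
    moreover have "\<Union> C = staircase p q xs"
      unfolding xs staircase_split[OF sorted u] C_def R0_def using C1(2) C2(2) by simp
    moreover have "pairwise disjnt C"
    proof -
      have "disjnt R0 R" if "R \<in> C1 \<union> C2" for R
        using that cells0 cells1 cells2 by (fastforce simp: disjnt_iff)
      moreover have "disjnt R R'" if "R \<in> C1" "R' \<in> C2" for R R'
        using cells1[OF that(1)] cells2[OF that(2)] by (fastforce simp: disjnt_iff)
      ultimately show ?thesis
        using C1(3) C2(3) unfolding C_def pairwise_def by (blast intro: disjnt_sym)
    qed
    moreover have "\<forall>R\<in>C. \<exists>a b c d. a \<le> b \<and> c \<le> d \<and> R = {a..b} \<times> {c..d}"
    proof -
      have "\<exists>a b c d. a \<le> b \<and> c \<le> d \<and> R0 = {a..b} \<times> {c..d}"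
        unfolding R0_def using u by (metis Suc_leI)
      then show ?thesis unfolding C_def using C1(4) C2(4) by blast
    qed
    moreover have "card {R \<in> C. s \<in> rows_used R} \<le> i" for s
    proof (cases "s \<le> fst u")
      case True
      then have "{R \<in> C. s \<in> rows_used R} \<subseteq> insert R0 {R \<in> C1. s \<in> rows_used R}"
        unfolding C_def rows_used_def using cells2 by fastforce
      then have "card {R \<in> C. s \<in> rows_used R} \<le> card (insert R0 {R \<in> C1. s \<in> rows_used R})"
        using C1(1) by (intro card_mono) auto
      also have "\<dots> \<le> Suc (card {R \<in> C1. s \<in> rows_used R})"
        by (rule card_insert_le_m1) auto
      finally show ?thesis using C1(5)[of s] ij by simp
    next
      case False
      then have "{R \<in> C. s \<in> rows_used R} \<subseteq> {R \<in> C2. s \<in> rows_used R}"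
        unfolding C_def rows_used_def using cells0 cells1 by fastforce
      then have "card {R \<in> C. s \<in> rows_used R} \<le> card {R \<in> C2. s \<in> rows_used R}"
        using C2(1) by (intro card_mono) auto
      then show ?thesis using C2(5)[of s] by simp
    qed
    moreover have "card {R \<in> C. t \<in> columns_used R} \<le> j" for t
    proof (cases "t \<le> snd u")
      case True
      then have "{R \<in> C. t \<in> columns_used R} \<subseteq> insert R0 {R \<in> C2. t \<in> columns_used R}"
        unfolding C_def columns_used_def using cells1 by fastforce
      then have "card {R \<in> C. t \<in> columns_used R} \<le> card (insert R0 {R \<in> C2. t \<in> columns_used R})"
        using C2(1) by (intro card_mono) auto
      also have "\<dots> \<le> Suc (card {R \<in> C2. t \<in> columns_used R})"
        by (rule card_insert_le_m1) auto
      finally show ?thesis using C2(6)[of t] ij by simp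
    next
      case False
      then have "{R \<in> C. t \<in> columns_used R} \<subseteq> {R \<in> C1. t \<in> columns_used R}"
        unfolding C_def columns_used_def using cells0 cells2 by fastforce
      then have "card {R \<in> C. t \<in> columns_used R} \<le> card {R \<in> C1. t \<in> columns_used R}"
        using C1(1) by (intro card_mono) auto
      then show ?thesis using C1(6)[of t] by simp
    qed
    ultimately show ?thesis by blast
  qed
qed

section \<open>Young diagrams and their steps\<close>

lemma young_diagram_finite: "young_diagram r c Y \<Longrightarrow> finite Y"
  unfolding young_diagram_def by (meson finite_SigmaI finite_atLeastAtMost finite_subset)

lemma young_diagram_downward_closed:
  assumes Y: "young_diagram r c Y" and "(a, b) \<in> Y" "1 \<le> s" "s \<le> a" "1 \<le> t" "t \<le> b"
  shows "(s, t) \<in> Y"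
proof -
  have "(s, b) \<in> Y"
    using \<open>s \<le> a\<close>
  proof (induction rule: inc_induct)
    case (step n)
    then show ?case using Y \<open>1 \<le> s\<close> unfolding young_diagram_def by fastforce
  qed (rule assms)
  show ?thesis
    using \<open>t \<le> b\<close>
  proof (induction rule: inc_induct)
    case (step n)
    then show ?case using Y \<open>1 \<le> t\<close> unfolding young_diagram_def by fastforce
  qed fact
qed

text \<open>If neither coordinate order is reversed, one step lies weakly above and to the left of
  the other, and downward closure puts the cell just below it or just to its right into
  \<open>Y\<close>.\<close>

lemma steps_antichain:
  assumes Y: "young_diagram r c Y" and u: "u \<in> steps Y" and v: "v \<in> steps Y"
    and "u \<noteq> v" and "fst u \<le> fst v"
  shows "descends u v"
proof -
  obtain a b a' b' where uv: "u = (a, b)" "v = (a', b')" by (cases u, cases v) auto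
  have pos: "1 \<le> a" "1 \<le> b" "1 \<le> b'"
    using Y u v unfolding uv steps_def young_diagram_def by auto
  have "\<not> (a < a' \<and> b \<le> b')"
    using young_diagram_downward_closed[OF Y, of a' b' "a + 1" b] u v pos
    unfolding uv steps_def by auto
  moreover have "\<not> (a = a' \<and> b < b')"
    using young_diagram_downward_closed[OF Y, of a' b' a "b + 1"] u v pos
    unfolding uv steps_def by auto
  moreover have "\<not> (a = a' \<and> b' < b)"
    using young_diagram_downward_closed[OF Y, of a b a' "b' + 1"] u v pos
    unfolding uv steps_def by auto
  ultimately show ?thesis using assms(4,5) unfolding uv descends_def by auto
qed

text \<open>Sorting by rows suffices: distinct steps in weakly increasing rows already descend
  strictly.\<close>

lemma steps_enumeration:
  assumes Y: "young_diagram r c Y"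
  obtains xs where "set xs = steps Y" "length xs = card (steps Y)" "sorted_wrt descends xs"
proof -
  have "finite (steps Y)"
    by (rule finite_subset[OF _ young_diagram_finite[OF Y]]) (auto simp: steps_def)
  then obtain ys where ys: "set ys = steps Y" "distinct ys" using finite_distinct_list by blast
  define xs where "xs = sort_key fst ys"
  have xs: "set xs = steps Y" "distinct xs" using ys by (auto simp: xs_def)
  have "sorted_wrt (\<lambda>u v. fst u \<le> fst v) xs"
    by (metis sorted_map sorted_sort_key xs_def)
  then have "sorted_wrt descends xs"
    unfolding sorted_wrt_iff_nth_less
    using xs by (auto simp: nth_eq_iff_index_eq intro!: steps_antichain[OF Y] simp flip: xs(1))
  then show thesis using that xs by (metis distinct_card)
qed

text \<open>Every cell is dominated by a step: among the cells of \<open>Y\<close> weakly below and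
  to the right of it, one with maximal coordinate sum has no neighbour below or to the right in
  \<open>Y\<close>. The other inclusion is downward closure.\<close>

lemma young_diagram_eq_staircase:
  assumes Y: "young_diagram r c Y" and xs: "set xs = steps Y"
  shows "Y = staircase 0 0 xs"
proof
  show "staircase 0 0 xs \<subseteq> Y"
    using young_diagram_downward_closed[OF Y] unfolding staircase_def xs
    by (fastforce simp: steps_def)
  show "Y \<subseteq> staircase 0 0 xs"
  proof
    fix x assume "x \<in> Y"
    define D where "D = {y \<in> Y. fst x \<le> fst y \<and> snd x \<le> snd y}"
    have "x \<in> D" using \<open>x \<in> Y\<close> by (simp add: D_def)
    have "finite D" using young_diagram_finite[OF Y] by (simp add: D_def)
    then obtain y where "y \<in> D" and y: "fst y + snd y = Max ((\<lambda>y. fst y + snd y) ` D)"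
      using \<open>x \<in> D\<close> Max_in[of "(\<lambda>y. fst y + snd y) ` D"] by fastforce
    have max: "fst y' + snd y' \<le> fst y + snd y" if "y' \<in> D" for y'
      unfolding y using that \<open>finite D\<close> by (intro Max_ge) auto
    have "y \<in> steps Y"
      using \<open>y \<in> D\<close> max[of "(fst y + 1, snd y)"] max[of "(fst y, snd y + 1)"]
      by (auto simp: steps_def D_def case_prod_beta)
    moreover have "0 < fst x" "0 < snd x" using \<open>x \<in> Y\<close> Y by (auto simp: young_diagram_def)
    ultimately show "x \<in> staircase 0 0 xs"
      using \<open>y \<in> D\<close> unfolding staircase_def xs D_def by (auto simp: case_prod_beta)
  qed
qed

section \<open>The two halves of the theorem\<close>

lemma exists_local_partition:
  assumes Y: "young_diagram r c Y" and "card (steps Y) < (i + j) choose i"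
  shows "\<exists>C. is_partition r c Y C \<and> (\<forall>R\<in>C. actual_rectangle r c Y R) \<and> is_local i j r c C"
proof -
  obtain xs where xs: "set xs = steps Y" "length xs = card (steps Y)" "sorted_wrt descends xs"
    by (rule steps_enumeration[OF Y])
  have Y_eq: "Y = staircase 0 0 xs" using young_diagram_eq_staircase[OF Y xs(1)] .
  have pos: "\<forall>u\<in>set xs. 0 < fst u \<and> 0 < snd u"
    using Y unfolding xs(1) by (auto simp: steps_def young_diagram_def)
  obtain C where C: "\<Union> C = Y" "pairwise disjnt C"
      "\<forall>R\<in>C. \<exists>a b c d. a \<le> b \<and> c \<le> d \<and> R = {a..b} \<times> {c..d}"
      "\<forall>s. card {R \<in> C. s \<in> rows_used R} \<le> i" "\<forall>t. card {R \<in> C. t \<in> columns_used R} \<le> j"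
    using staircase_local_partition[OF assms(2)[folded xs(2)] xs(3) pos, folded Y_eq]
    by - (elim exE conjE, rule that)
  have actual: "actual_rectangle r c Y R" if R: "R \<in> C" for R
  proof -
    obtain a b d e where abde: "a \<le> b" "d \<le> e" "R = {a..b} \<times> {d..e}"
      using C(3)[rule_format, OF R] by (elim exE conjE)
    have "R \<subseteq> Y" using R C(1) by blast
    moreover have "{a..b} \<times> {d..e} \<subseteq> {1..r} \<times> {1..c}"
      using Y \<open>R \<subseteq> Y\<close> unfolding young_diagram_def abde(3)[symmetric]
      by (blast dest: subset_trans)
    \<comment> \<open>Both intervals are nonempty, so the inclusion of the products passes to the
      factors.\<close>
    then have "{a..b} \<subseteq> {1..r}" "{d..e} \<subseteq> {1..c}"
      using abde(1,2) by (auto simp: times_subset_iff)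
    ultimately show ?thesis
      using abde unfolding actual_rectangle_def consecutive_def
      by (intro exI[of _ "{a..b}"] exI[of _ "{d..e}"]) auto
  qed
  then have "generalized_rectangle r c Y R" if "R \<in> C" for R
    using that unfolding generalized_rectangle_def actual_rectangle_def
    by (meson order_refl)
  then have "is_partition r c Y C"
    using C(1,2) unfolding is_partition_def is_cover_def by blast
  then show ?thesis using actual C(4,5) unfolding is_local_def by blast
qed

lemma local_cover_imp_card_steps_less:
  assumes Y: "young_diagram r c Y" and cover: "is_cover r c Y C" and loc: "is_local i j r c C"
  shows "card (steps Y) < (i + j) choose i"
proof -
  obtain xs where xs: "set xs = steps Y" "length xs = card (steps Y)" "sorted_wrt descends xs"
    by (rule steps_enumeration[OF Y])
  define A where "A k = {R \<in> C. fst (xs ! k) \<in> rows_used R}" for k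
  define B where "B k = {R \<in> C. snd (xs ! k) \<in> columns_used R}" for k
  have "C \<subseteq> Pow Y" using cover unfolding is_cover_def by blast
  then have "finite C" using young_diagram_finite[OF Y] by (meson finite_Pow_iff finite_subset)
  have step: "(fst (xs ! k), snd (xs ! k)) \<in> steps Y" if "k < length xs" for k
    using that xs(1) nth_mem by fastforce
  have range: "fst (xs ! k) \<in> {1..r}" "snd (xs ! k) \<in> {1..c}" if "k < length xs" for k
    using step[OF that] Y by (auto simp: steps_def young_diagram_def)
  have desc: "fst (xs ! k) < fst (xs ! l) \<and> snd (xs ! l) < snd (xs ! k)"
    if "k < l" "l < length xs" for k l
    using sorted_wrt_nth_less[OF xs(3) that] by (simp add: descends_def)
  have "length xs - 0 < (i + j) choose i"
  proof (rule triangular_intersections_less_choose[of 0 "length xs" A i B j])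
    fix k assume k: "0 \<le> k" "k < length xs"
    show "finite (A k) \<and> card (A k) \<le> i"
      using loc range[OF k(2)] \<open>finite C\<close> unfolding A_def is_local_def by simp
    show "finite (B k) \<and> card (B k) \<le> j"
      using loc range[OF k(2)] \<open>finite C\<close> unfolding B_def is_local_def by simp
  next
    fix k l assume kl: "0 \<le> k" "k \<le> l" "l < length xs"
    \<comment> \<open>The crossing of the row of step \<open>k\<close> with the column of step
      \<open>l\<close> lies weakly above step \<open>l\<close>, hence in \<open>Y\<close>, and any
      rectangle covering it belongs to both families.\<close>
    have "fst (xs ! k) \<le> fst (xs ! l)" using desc[of k l] kl by (cases "k = l") auto
    then have "(fst (xs ! k), snd (xs ! l)) \<in> Y"
      using young_diagram_downward_closed[OF Y, of "fst (xs ! l)" "snd (xs ! l)"]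
        step[OF kl(3)] range[of k] range[of l] kl
      by (simp add: steps_def case_prod_unfold)
    then obtain R where R: "R \<in> C" "(fst (xs ! k), snd (xs ! l)) \<in> R"
      using cover unfolding is_cover_def by blast
    then have "R \<in> A k \<inter> B l"
      using imageI[OF R(2), of fst] imageI[OF R(2), of snd]
      unfolding A_def B_def rows_used_def columns_used_def by simp
    then show "A k \<inter> B l \<noteq> {}" by blast
  next
    fix k l assume kl: "0 \<le> l" "l < k" "k < length xs"
    show "A k \<inter> B l = {}"
    proof (rule ccontr)
      assume "A k \<inter> B l \<noteq> {}"
      then obtain R where R: "R \<in> C" "fst (xs ! k) \<in> fst ` R" "snd (xs ! l) \<in> snd ` R"
        unfolding A_def B_def rows_used_def columns_used_def by blast
      have "generalized_rectangle r c Y R" using R(1) cover by (simp add: is_cover_def)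
      then obtain S T where "R = S \<times> T" "R \<subseteq> Y" unfolding generalized_rectangle_def by metis
      \<comment> \<open>Here the product form of \<open>R\<close> enters: using this row and this
        column forces \<open>R\<close> to contain their crossing. It lies strictly below step
        \<open>l\<close> in the same column, so the cell just below that step would be in
        \<open>Y\<close>.\<close>
      then have "(fst (xs ! k), snd (xs ! l)) \<in> Y" using R(2,3) by (auto split: if_splits)
      then have "(fst (xs ! l) + 1, snd (xs ! l)) \<in> Y"
        using young_diagram_downward_closed[OF Y] desc[OF kl(2,3)] range[of l] kl by simp
      then show False using step[of l] kl by (auto simp: steps_def)
    qed
  qed
  then show ?thesis using xs(2) by simp
qed

theorem theorem3:
  fixes i j z r c :: nat and Y :: "cell set"
  assumes "1 \<le> i" and "1 \<le> j" and "1 \<le> z"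
    and "young_diagram r c Y"
    and "card (steps Y) = z"
  shows "(z < (i + j) choose i \<longrightarrow>
            (\<exists>C. is_partition r c Y C \<and> (\<forall>R\<in>C. actual_rectangle r c Y R) \<and>
                 is_local i j r c C)) \<and>
         (z \<ge> (i + j) choose i \<longrightarrow>
            \<not> (\<exists>C. is_cover r c Y C \<and> is_local i j r c C))"
  using exists_local_partition local_cover_imp_card_steps_less assms by (metis not_less)

end
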